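(* Let $0=t_0<t_1<\dots<t_N=1$ be a grid with constant step size $h=t_{n+1}-t_n$. Let $T_n,\widetilde T_n:\mathbb{R}^d\to\mathbb{R}^d$ ($n=0,\dots,N-1$) be the exact and approximate transport maps, and let $\overset{\leftarrow}{P}_{t_n}$, $\overset{\leftarrow}{Q}_{t_n}$ be the associated push-forward distributions (see context). Assume: (1) (second moment) the target (data) distribution $\overset{\rightarrow}{P}_0=\overset{\leftarrow}{P}_1$ has bounded second moment $M_2:=\mathbb{E}|x|^2<\infty$; put $M_0=\max\{\operatorname{Tr}(C),M_2\}$, where $C$ is a symmetric positive-definite covariance matrix; (2) $\mathrm{Lip}(T_n)<\infty$ and $\prod_{j=0}^n\mathrm{Lip}(T_j)<\infty$ for all $n=0,\dots,N-1$; (3) $\mathrm{Lip}(\widetilde T_n)<\infty$ and $\prod_{j=0}^n\mathrm{Lip}(\widetilde T_j)<\infty$ for all $n=0,\dots,N-1$; (4) there exist constants $\bar K,\bar K_1,\bar K_2,\epsilon$ such that $$\sqrt{\mathbb{E}_{x\sim\overset{\leftarrow}{P}_{t_n}}|\widetilde T_n(x)-T_n(x)|^2}\le h\left(\Big(\bar K\sqrt{M_0}+\frac{\bar K_1}{\sqrt{1-t_n^2}}+\bar K_2\Big)h+\epsilon\right).$$ Then the Wasserstein-2 distance between the target distribution $\overset{\rightarrow}{P}_0=\overset{\leftarrow}{P}_1$ and the generated distribution $\overset{\leftarrow}{Q}_1$ is bounded by $$\mathcal{W}_2(\overset{\leftarrow}{P}_1,\overset{\leftarrow}{Q}_1)\le\left(\prod_{j=0}^{N-1}\mathrm{Lip}(\widetilde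 T_j)\right)\mathcal{W}_2(\overset{\leftarrow}{P}_0,\overset{\leftarrow}{Q}_0)+h\sum_{k=0}^{N-2}\prod_{j=k}^{N-2}\mathrm{Lip}(\widetilde T_j)\left(\Big(\bar K\sqrt{M_0}+\frac{\bar K_1}{\sqrt{1-t_k^2}}+\bar K_2\Big)h+\epsilon\right).$$
   Context: $|\cdot|$ is the Euclidean norm, $\mathrm{Lip}(F)$ the global Lipschitz constant of a map $F:\mathbb{R}^d\to\mathbb{R}^d$, and $\mathcal{W}_2$ the Wasserstein-2 distance with Euclidean cost. The exact flow is $\frac{d}{dt}\overset{\leftarrow}{X}_t=V(t,\overset{\leftarrow}{X}_t)$ on $[0,1]$ for a velocity field $V$, and $T_n$ is its flow map from time $t_n$ to time $t_{n+1}$, i.e. $T_n(\overset{\leftarrow}{X}_{t_n})=\overset{\leftarrow}{X}_{t_{n+1}}$. The maps $\widetilde T_n$ are approximations of $T_n$. Given initial probability distributions $\overset{\leftarrow}{P}_0$ and $\overset{\leftarrow}{Q}_0$ on $\mathbb{R}^d$, the marginals are $\overset{\leftarrow}{P}_{t_{n+1}}=(T_n)_\#\overset{\leftarrow}{P}_{t_n}$ and $\overset{\leftarrow}{Q}_{t_{n+1}}=(\widetilde T_n)_\#\overset{\leftarrow}{Q}_{t_n}$. The target (data) distribution is $\overset{\rightarrow}{P}_0=\overset{\leftarrow}{P}_1$ and the generated distribution is $\overset{\leftarrow}{Q}_1$.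
   Formalization: The error sum runs over k=0..N-1 with product over j=k+1..N-1, instead of k=0..N-2 and j=k..N-2; the printed bound fails for V=0, T_n=id, approximate maps x+c, both initial laws a point mass at 0 (left N|c|, right (N-1)|c|). *)

theory Defs
  imports "HOL-Probability.Probability"
begin

text \<open>
  The global Lipschitz constant, i.e. the least constant in the sense of
  \<^const>\<open>lipschitz_on\<close>; it is \<open>\<infinity>\<close> if the map is not Lipschitz.
\<close>

definition Lip :: "('a::metric_space \<Rightarrow> 'b::metric_space) \<Rightarrow> ennreal" where
  "Lip F = Inf {ennreal L | L. L-lipschitz_on UNIV F}"

definition couplings :: "'a::euclidean_space measure \<Rightarrow> 'a measure \<Rightarrow> ('a \<times> 'a) measure set" where
  "couplings P Q = {\<gamma>. sets \<gamma> = sets (borel \<Otimes>\<^sub>M borel) \<and>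
     distr \<gamma> borel fst = P \<and> distr \<gamma> borel snd = Q}"

definition ennsqrt :: "ennreal \<Rightarrow> ennreal" where
  "ennsqrt c = (if c = \<infinity> then \<infinity> else ennreal (sqrt (enn2real c)))"

text \<open>
  The value \<open>\<infinity>\<close> is possible, since \<open>P\<close> and \<open>Q\<close> need not have second moments.
\<close>

definition W2 :: "'a::euclidean_space measure \<Rightarrow> 'a measure \<Rightarrow> ennreal" where
  "W2 P Q = ennsqrt (INF \<gamma>\<in>couplings P Q. \<integral>\<^sup>+ z. ennreal ((norm (fst z - snd z))\<^sup>2) \<partial>\<gamma>)"

definition ode_solution ::
  "(real \<Rightarrow> 'a::real_normed_vector \<Rightarrow> 'a) \<Rightarrow> real \<Rightarrow> real \<Rightarrow> (real \<Rightarrow> 'a) \<Rightarrow> bool" where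
  "ode_solution V a b X \<longleftrightarrow>
     (\<forall>s\<in>{a..b}. (X has_vector_derivative V s (X s)) (at s within {a..b}))"

text \<open>
  \<open>F\<close> is the flow map of \<open>V\<close> from time \<open>a\<close> to time \<open>b\<close>: from every point there starts a solution
  at time \<open>a\<close>, and every solution on \<open>[a, b]\<close> is mapped from its value at \<open>a\<close> to its value at \<open>b\<close>.
\<close>

definition is_flow_map ::
  "(real \<Rightarrow> 'a::real_normed_vector \<Rightarrow> 'a) \<Rightarrow> real \<Rightarrow> real \<Rightarrow> ('a \<Rightarrow> 'a) \<Rightarrow> bool" where
  "is_flow_map V a b F \<longleftrightarrow>
     (\<forall>x. \<exists>X. ode_solution V a b X \<and> X a = x) \<and>
     (\<forall>X. ode_solution V a b X \<longrightarrow> F (X a) = X b)"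

primrec marginal :: "(nat \<Rightarrow> 'a \<Rightarrow> 'a) \<Rightarrow> 'a::topological_space measure \<Rightarrow> nat \<Rightarrow> 'a measure" where
  "marginal S M 0 = M"
| "marginal S M (Suc n) = distr (marginal S M n) borel (S n)"

definition sym_pos_def :: "real^'d^'d \<Rightarrow> bool" where
  "sym_pos_def C \<longleftrightarrow> transpose C = C \<and> (\<forall>x. x \<noteq> 0 \<longrightarrow> 0 < x \<bullet> (C *v x))"

text \<open>
  Index ranges of the error bound proved from these notions. One step gives
  \<open>W2 P(k+1) Q(k+1) \<le> Lip(T~ k) * W2 P(k) Q(k) + err k\<close>, so the error of step \<open>k\<close> is amplified by the
  later maps \<open>T~ j\<close>, \<open>k < j < N\<close>, and all steps \<open>k < N\<close> contribute, the last one with an empty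
  product. With the ranges \<open>k \<le> N - 2\<close> and \<open>k \<le> j \<le> N - 2\<close> found in the source the inequality is
  false for every \<open>N \<ge> 1\<close>: take \<open>V = 0\<close>, every \<open>T~ j\<close> the translation by some \<open>c \<noteq> 0\<close>, both initial
  distributions the point mass at 0, \<open>K = K1 = K2 = 0\<close> and \<open>\<epsilon> = norm c / h\<close>; the left side is \<open>N * norm c\<close>, the right \<open>(N - 1) * norm c\<close>.
  The extended nonnegative reals do not truncate anything there, since the assumed bound on the
  one-step error makes each summand nonnegative.
\<close>

end

theory Submission
  imports Defs
begin

text \<open>
  No gluing of couplings is needed: a coupling of \<open>P\<^sub>0\<close> and \<open>Q\<^sub>0\<close> is carried along by the pairs
  of maps \<open>(T n, T' n)\<close>, so that at every time it couples the two marginals. Under it, Minkowski's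
  inequality in \<open>L\<^sup>2\<close> splits \<open>T n x - T' n y\<close> into \<open>T n x - T' n x\<close>, whose \<open>x\<close> has the exact
  marginal, and \<open>T' n x - T' n y\<close>, which \<open>Lip (T' n)\<close> controls. Unrolling this recursion and
  minimising over the initial coupling only gives the bound.
\<close>

text \<open>\<open>ennsqrt\<close> is adjoint to squaring. Comparisons with a root thereby become
  comparisons of squares, with the value \<open>\<infinity>\<close> included.\<close>

lemma le_ennsqrt_iff: "y \<le> ennsqrt x \<longleftrightarrow> y\<^sup>2 \<le> x"
proof (cases x)
  case (real r)
  show ?thesis
  proof (cases y)
    case y: (real s)
    have "s \<le> sqrt r \<longleftrightarrow> s\<^sup>2 \<le> r"
      using y real by (metis real_sqrt_le_iff real_sqrt_unique)
    then show ?thesis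
      using y real by (simp add: ennsqrt_def ennreal_power)
  qed (use real in \<open>simp add: ennsqrt_def top_unique power2_eq_square ennreal_top_mult\<close>)
qed (simp add: ennsqrt_def)

lemma ennsqrt_power2 [simp]: "(ennsqrt x)\<^sup>2 = x"
proof (cases x)
  case (real r)
  then show ?thesis by (simp add: ennsqrt_def ennreal_power)
qed (simp add: ennsqrt_def power2_eq_square ennreal_top_mult)

lemma ennsqrt_mono: "x \<le> y \<Longrightarrow> ennsqrt x \<le> ennsqrt y"
  by (simp add: le_ennsqrt_iff)

lemma ennsqrt_of_power2 [simp]: "ennsqrt (y\<^sup>2) = y"
proof (cases y)
  case (real r)
  then show ?thesis by (simp add: ennsqrt_def ennreal_power)
qed (simp add: ennsqrt_def power2_eq_square ennreal_top_mult)

lemma power2_le_power2_ennreal_iff: "a\<^sup>2 \<le> b\<^sup>2 \<longleftrightarrow> a \<le> b" for a b :: ennreal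
  by (metis ennsqrt_of_power2 le_ennsqrt_iff)

lemma ennsqrt_le_iff: "ennsqrt x \<le> y \<longleftrightarrow> x \<le> y\<^sup>2"
  by (metis ennsqrt_power2 power2_le_power2_ennreal_iff)

lemma ennsqrt_mult: "ennsqrt (x * y) = ennsqrt x * ennsqrt y"
  by (metis ennsqrt_of_power2 ennsqrt_power2 power_mult_distrib)

lemma ennsqrt_ennreal: "0 \<le> r \<Longrightarrow> ennsqrt (ennreal r) = ennreal (sqrt r)"
  by (simp add: ennsqrt_def)

text \<open>Upper adjoints preserve infima; the empty infimum is covered, as \<open>ennsqrt\<close>
  fixes \<open>\<infinity>\<close>. This moves the root in \<open>W2\<close> inside, to each single
  coupling.\<close>

lemma ennsqrt_INF: "ennsqrt (INF i\<in>A. f i) = (INF i\<in>A. ennsqrt (f i))"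
proof (rule antisym)
  show "ennsqrt (INF i\<in>A. f i) \<le> (INF i\<in>A. ennsqrt (f i))"
    by (intro INF_greatest ennsqrt_mono INF_lower)
  have "(INF i\<in>A. ennsqrt (f i))\<^sup>2 \<le> f i" if "i \<in> A" for i
    unfolding le_ennsqrt_iff[symmetric] by (rule INF_lower[OF that])
  then show "(INF i\<in>A. ennsqrt (f i)) \<le> ennsqrt (INF i\<in>A. f i)"
    by (simp add: le_ennsqrt_iff le_INF_iff)
qed

text \<open>Expand the square and bound the cross term by Cauchy-Schwarz. All terms live in
  \<open>ennreal\<close>, so infinite norms go through the same computation.\<close>

lemma Minkowski_nn_integral:
  assumes [measurable]: "f \<in> borel_measurable M" "g \<in> borel_measurable M"
  shows "ennsqrt (\<integral>\<^sup>+x. (f x + g x)\<^sup>2 \<partial>M) \<le> ennsqrt (\<integral>\<^sup>+x. (f x)\<^sup>2 \<partial>M) + ennsqrt (\<integral>\<^sup>+x. (g x)\<^sup>2 \<partial>M)"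
    (is "_ \<le> ?a + ?b")
proof -
  have "(\<integral>\<^sup>+x. f x * g x \<partial>M)\<^sup>2 \<le> (?a * ?b)\<^sup>2"
    using Cauchy_Schwarz_nn_integral[OF assms] by (simp add: power_mult_distrib)
  then have cs: "(\<integral>\<^sup>+x. f x * g x \<partial>M) \<le> ?a * ?b"
    by (simp add: power2_le_power2_ennreal_iff)
  have "(\<integral>\<^sup>+x. (f x + g x)\<^sup>2 \<partial>M) = (\<integral>\<^sup>+x. (f x)\<^sup>2 + (g x)\<^sup>2 + 2 * (f x * g x) \<partial>M)"
    by (simp add: power2_sum mult.assoc)
  also have "\<dots> = (\<integral>\<^sup>+x. (f x)\<^sup>2 \<partial>M) + (\<integral>\<^sup>+x. (g x)\<^sup>2 \<partial>M) + 2 * (\<integral>\<^sup>+x. f x * g x \<partial>M)"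
    by (simp add: nn_integral_add nn_integral_cmult)
  also have "\<dots> \<le> ?a\<^sup>2 + ?b\<^sup>2 + 2 * (?a * ?b)"
    using cs by (simp add: add_left_mono mult_left_mono)
  also have "\<dots> = (?a + ?b)\<^sup>2"
    unfolding power2_sum by (simp only: mult.assoc)
  finally show ?thesis
    by (simp only: ennsqrt_le_iff)
qed

text \<open>The infimum defining \<open>Lip F\<close> is itself a Lipschitz bound: every difference
  quotient lies below all admissible constants. For a map that is not Lipschitz the right side is
  \<open>\<infinity>\<close> unless \<open>x = y\<close>.\<close>

lemma dist_le_Lip: "ennreal (dist (F x) (F y)) \<le> Lip F * ennreal (dist x y)"
proof (cases "x = y")
  case False
  then have pos: "0 < dist x y" by simp
  then have eq: "ennreal (dist (F x) (F y)) = ennreal (dist (F x) (F y) / dist x y) * ennreal (dist x y)"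
    by (subst ennreal_mult'[symmetric]) auto
  have "ennreal (dist (F x) (F y) / dist x y) \<le> Lip F"
    unfolding Lip_def
  proof (rule Inf_greatest, clarify)
    fix L assume "L-lipschitz_on UNIV F"
    then have "dist (F x) (F y) \<le> L * dist x y"
      by (auto simp: lipschitz_on_def)
    then show "ennreal (dist (F x) (F y) / dist x y) \<le> ennreal L"
      using pos by (intro ennreal_leI) (metis pos_divide_le_eq)
  qed
  then show ?thesis
    by (subst eq) (rule mult_right_mono, simp_all)
qed simp

text \<open>A finite infimum means that some Lipschitz constant exists, so the map is continuous.
  This is how the transport maps become measurable, as the push-forwards require.\<close>

lemma borel_measurable_Lip:
  assumes "Lip F < \<infinity>"
  shows "F \<in> borel_measurable borel"
proof -
  obtain L where "L-lipschitz_on UNIV F"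
    using assms unfolding Lip_def by (auto simp: Inf_less_iff)
  then show ?thesis
    by (intro borel_measurable_continuous_onI lipschitz_on_continuous_on)
qed

lemma couplings_nonempty:
  fixes P Q :: "'a::euclidean_space measure"
  assumes "prob_space P" "sets P = sets borel" "prob_space Q" "sets Q = sets borel"
  shows "P \<Otimes>\<^sub>M Q \<in> couplings P Q"
proof -
  interpret P: prob_space P by fact
  interpret Q: prob_space Q by fact
  interpret PQ: pair_sigma_finite P Q ..
  have sets: "sets (P \<Otimes>\<^sub>M Q) = sets (borel \<Otimes>\<^sub>M borel)"
    using assms by (intro sets_pair_measure_cong)
  have "distr (P \<Otimes>\<^sub>M Q) borel fst = distr (P \<Otimes>\<^sub>M Q) P fst"
    using assms by (intro distr_cong) auto
  then have fst: "distr (P \<Otimes>\<^sub>M Q) borel fst = P"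
    by (simp add: Q.distr_pair_fst)
  have "distr (P \<Otimes>\<^sub>M Q) borel snd = distr (P \<Otimes>\<^sub>M Q) Q snd"
    using assms by (intro distr_cong) auto
  \<comment> \<open>Swapping the factors reduces the second projection to the first.\<close>
  also have "\<dots> = distr (distr (Q \<Otimes>\<^sub>M P) (P \<Otimes>\<^sub>M Q) (\<lambda>(x, y). (y, x))) Q snd"
    by (rule arg_cong[where f="\<lambda>M. distr M Q snd", OF PQ.distr_pair_swap])
  also have "\<dots> = distr (Q \<Otimes>\<^sub>M P) Q fst"
    by (subst distr_distr) (auto intro!: distr_cong)
  finally show ?thesis
    using sets fst by (simp add: couplings_def P.distr_pair_fst)
qed

text \<open>The \<open>L\<^sup>2\<close> norm of the displacement under one coupling. With the root
  taken here, Minkowski makes the one-step recursion linear.\<close>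

definition coupling_cost :: "('a::euclidean_space \<times> 'a) measure \<Rightarrow> ennreal" where
  "coupling_cost \<gamma> = ennsqrt (\<integral>\<^sup>+ z. ennreal ((norm (fst z - snd z))\<^sup>2) \<partial>\<gamma>)"

lemma W2_eq_INF_coupling_cost: "W2 P Q = (INF \<gamma>\<in>couplings P Q. coupling_cost \<gamma>)"
  by (simp add: W2_def coupling_cost_def ennsqrt_INF)

lemma coupling_step:
  fixes S S' :: "'a::euclidean_space \<Rightarrow> 'a"
  assumes \<gamma>: "\<gamma> \<in> couplings P Q"
    and [measurable]: "S \<in> borel_measurable borel" "S' \<in> borel_measurable borel"
  defines "\<gamma>' \<equiv> distr \<gamma> (borel \<Otimes>\<^sub>M borel) (\<lambda>z. (S (fst z), S' (snd z)))"
  shows "\<gamma>' \<in> couplings (distr P borel S) (distr Q borel S')"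
    and "coupling_cost \<gamma>' \<le> Lip S' * coupling_cost \<gamma>
      + ennsqrt (\<integral>\<^sup>+ x. ennreal ((norm (S' x - S x))\<^sup>2) \<partial>P)"
proof -
  have [measurable_cong]: "sets \<gamma> = sets (borel \<Otimes>\<^sub>M borel)"
    and P: "P = distr \<gamma> borel fst" and Q: "Q = distr \<gamma> borel snd"
    using \<gamma> by (auto simp: couplings_def)
  show "\<gamma>' \<in> couplings (distr P borel S) (distr Q borel S')"
    unfolding couplings_def \<gamma>'_def P Q by (simp add: distr_distr comp_def)
  let ?d = "\<lambda>z. ennreal (norm (fst z - snd z))"
  let ?e = "\<lambda>z. ennreal (norm (S' (fst z) - S (fst z)))"
  have "coupling_cost \<gamma>' = ennsqrt (\<integral>\<^sup>+z. (ennreal (norm (S (fst z) - S' (snd z))))\<^sup>2 \<partial>\<gamma>)"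
    unfolding coupling_cost_def \<gamma>'_def by (simp add: nn_integral_distr ennreal_power)
  also have "\<dots> \<le> ennsqrt (\<integral>\<^sup>+z. (Lip S' * ?d z + ?e z)\<^sup>2 \<partial>\<gamma>)"
  proof (intro ennsqrt_mono nn_integral_mono power_mono)
    fix z
    \<comment> \<open>The intermediate point \<open>S' (fst z)\<close> puts the one-step error at
      the first coordinate, whose law is \<open>P\<close>, and leaves the Lipschitz constant to
      \<open>S'\<close>.\<close>
    have "norm (S (fst z) - S' (snd z)) \<le> dist (S' (fst z)) (S' (snd z)) + norm (S' (fst z) - S (fst z))"
      by norm
    then have "ennreal (norm (S (fst z) - S' (snd z)))
      \<le> ennreal (dist (S' (fst z)) (S' (snd z))) + ?e z"
      by (simp flip: ennreal_plus)
    also have "\<dots> \<le> Lip S' * ?d z + ?e z"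
      using dist_le_Lip[of S' "fst z" "snd z"] by (intro add_right_mono) (simp add: dist_norm)
    finally show "ennreal (norm (S (fst z) - S' (snd z))) \<le> Lip S' * ?d z + ?e z" .
  qed simp
  also have "\<dots> \<le> ennsqrt (\<integral>\<^sup>+z. (Lip S' * ?d z)\<^sup>2 \<partial>\<gamma>) + ennsqrt (\<integral>\<^sup>+z. (?e z)\<^sup>2 \<partial>\<gamma>)"
    by (rule Minkowski_nn_integral) measurable
  also have "ennsqrt (\<integral>\<^sup>+z. (Lip S' * ?d z)\<^sup>2 \<partial>\<gamma>) = Lip S' * coupling_cost \<gamma>"
    by (simp add: power_mult_distrib nn_integral_cmult ennsqrt_mult coupling_cost_def ennreal_power)
  also have "(\<integral>\<^sup>+z. (?e z)\<^sup>2 \<partial>\<gamma>) = (\<integral>\<^sup>+ x. ennreal ((norm (S' x - S x))\<^sup>2) \<partial>P)"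
    unfolding P by (simp add: nn_integral_distr ennreal_power)
  finally show "coupling_cost \<gamma>' \<le> Lip S' * coupling_cost \<gamma>
      + ennsqrt (\<integral>\<^sup>+ x. ennreal ((norm (S' x - S x))\<^sup>2) \<partial>P)" .
qed

text \<open>A discrete Gronwall argument: the error made at step \<open>k\<close> passes only
  through the maps after \<open>k\<close>, whence the open range \<open>{k<..<n}\<close>.\<close>

lemma marginal_coupling:
  fixes S S' :: "nat \<Rightarrow> 'a::euclidean_space \<Rightarrow> 'a"
  assumes \<gamma>: "\<gamma> \<in> couplings P Q"
    and meas: "\<And>j. j < n \<Longrightarrow> S j \<in> borel_measurable borel"
    and meas': "\<And>j. j < n \<Longrightarrow> S' j \<in> borel_measurable borel"
    and err: "\<And>j. j < n \<Longrightarrow>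
      ennsqrt (\<integral>\<^sup>+ x. ennreal ((norm (S' j x - S j x))\<^sup>2) \<partial>marginal S P j) \<le> e j"
  shows "\<exists>\<gamma>'\<in>couplings (marginal S P n) (marginal S' Q n).
    coupling_cost \<gamma>' \<le> (\<Prod>j<n. Lip (S' j)) * coupling_cost \<gamma>
      + (\<Sum>k<n. (\<Prod>j\<in>{k<..<n}. Lip (S' j)) * e k)"
  using meas meas' err
proof (induction n)
  case 0
  then show ?case using \<gamma> by auto
next
  case (Suc n)
  let ?B = "\<lambda>n. (\<Prod>j<n. Lip (S' j)) * coupling_cost \<gamma>
      + (\<Sum>k<n. (\<Prod>j\<in>{k<..<n}. Lip (S' j)) * e k)"
  obtain \<gamma>' where \<gamma>': "\<gamma>' \<in> couplings (marginal S P n) (marginal S' Q n)"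
    and cost: "coupling_cost \<gamma>' \<le> ?B n"
    using Suc by (meson less_SucI)
  have prods: "(\<Prod>j\<in>{k<..<Suc n}. Lip (S' j)) = Lip (S' n) * (\<Prod>j\<in>{k<..<n}. Lip (S' j))"
    if "k < n" for k
  proof -
    have "{k<..<Suc n} = insert n {k<..<n}" using that by auto
    then show ?thesis by simp
  qed
  \<comment> \<open>The newest error has not been amplified yet: its product is empty, so it enters
    as plain \<open>e n\<close>.\<close>
  have "{n<..<Suc n} = {}" by auto
  then have B: "?B (Suc n) = Lip (S' n) * ?B n + e n"
    by (simp add: prods algebra_simps sum_distrib_left)
  let ?\<gamma> = "distr \<gamma>' (borel \<Otimes>\<^sub>M borel) (\<lambda>z. (S n (fst z), S' n (snd z)))"
  have "coupling_cost ?\<gamma> \<le> Lip (S' n) * coupling_cost \<gamma>' + e n"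
    using coupling_step(2)[OF \<gamma>' Suc.prems(1,2)] Suc.prems(3)[of n]
    by (meson add_left_mono lessI order_trans)
  also have "\<dots> \<le> ?B (Suc n)"
    unfolding B using cost by (intro add_right_mono mult_left_mono) auto
  finally show ?case
    using coupling_step(1)[OF \<gamma>' Suc.prems(1,2)] by auto
qed

text \<open>
  The couplings must be nonempty here: otherwise \<open>W2 P Q = \<infinity>\<close>, but \<open>a * W2 P Q = 0\<close> for \<open>a = 0\<close>.
\<close>

lemma le_mult_W2_plusI:
  assumes le: "\<And>\<gamma>. \<gamma> \<in> couplings P Q \<Longrightarrow> x \<le> a * coupling_cost \<gamma> + b"
    and ne: "couplings P Q \<noteq> {}" and a: "a < \<infinity>"
  shows "x \<le> a * W2 P Q + b"
\<comment> \<open>Outside these cases \<open>b\<close> can be subtracted and \<open>a\<close>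
  divided out, which turns the hypothesis into a lower bound for every coupling cost and hence for
  the infimum.\<close>
proof (cases "a = 0 \<or> b = \<infinity>")
  case True
  then show ?thesis using le ne by fastforce
next
  case False
  have "(x - b) / a \<le> W2 P Q"
    unfolding W2_eq_INF_coupling_cost
  proof (rule INF_greatest)
    fix \<gamma> assume "\<gamma> \<in> couplings P Q"
    then have "x - b \<le> a * coupling_cost \<gamma>"
      using le[of \<gamma>] False by (auto simp: ennreal_minus_le_iff add.commute)
    then show "(x - b) / a \<le> coupling_cost \<gamma>"
      using False a by (intro divide_le_posI_ennreal) (auto simp: zero_less_iff_neq_zero)
  qed
  then have "(x - b) / a * a \<le> W2 P Q * a"
    by (rule mult_right_mono) simp
  then have "x - b \<le> a * W2 P Q"
    using False a by (simp add: ennreal_divide_times mult_divide_eq_ennreal mult.commute[of a])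
  then show ?thesis
    using False by (auto simp: ennreal_minus_le_iff add.commute)
qed

theorem theorem3p5:
  fixes N :: nat and t :: "nat \<Rightarrow> real" and h :: real
    and V :: "real \<Rightarrow> real^'d \<Rightarrow> real^'d"
    and T T' :: "nat \<Rightarrow> real^'d \<Rightarrow> real^'d"
    and P\<^sub>0 Q\<^sub>0 :: "(real^'d) measure"
    and C :: "real^'d^'d"
    and M\<^sub>0 M\<^sub>2 K K\<^sub>1 K\<^sub>2 \<epsilon> :: real
  assumes grid: "t 0 = 0" "t N = 1"
      "\<forall>n<N. t n < t (Suc n) \<and> t (Suc n) - t n = h"
    and flow: "\<forall>n<N. is_flow_map V (t n) (t (Suc n)) (T n)"
    and init: "prob_space P\<^sub>0" "sets P\<^sub>0 = sets borel"
      "prob_space Q\<^sub>0" "sets Q\<^sub>0 = sets borel"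
    and second_moment: "integrable (marginal T P\<^sub>0 N) (\<lambda>x. (norm x)\<^sup>2)"
      "M\<^sub>2 = (\<integral>x. (norm x)\<^sup>2 \<partial>(marginal T P\<^sub>0 N))"
    and cov: "sym_pos_def C" "M\<^sub>0 = max (trace C) M\<^sub>2"
    and Lip_T: "\<forall>n<N. Lip (T n) < \<infinity> \<and> (\<Prod>j\<le>n. Lip (T j)) < \<infinity>"
    and Lip_T': "\<forall>n<N. Lip (T' n) < \<infinity> \<and> (\<Prod>j\<le>n. Lip (T' j)) < \<infinity>"
    and step_error: "\<forall>n<N.
      integrable (marginal T P\<^sub>0 n) (\<lambda>x. (norm (T' n x - T n x))\<^sup>2) \<and>
      sqrt (\<integral>x. (norm (T' n x - T n x))\<^sup>2 \<partial>(marginal T P\<^sub>0 n))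
        \<le> h * ((K * sqrt M\<^sub>0 + K\<^sub>1 / sqrt (1 - (t n)\<^sup>2) + K\<^sub>2) * h + \<epsilon>)"
  shows "W2 (marginal T P\<^sub>0 N) (marginal T' Q\<^sub>0 N)
    \<le> (\<Prod>j<N. Lip (T' j)) * W2 P\<^sub>0 Q\<^sub>0
      + ennreal h * (\<Sum>k<N. (\<Prod>j\<in>{k<..<N}. Lip (T' j)) *
          ennreal ((K * sqrt M\<^sub>0 + K\<^sub>1 / sqrt (1 - (t k)\<^sup>2) + K\<^sub>2) * h + \<epsilon>))"
proof -
  define c where "c k = (K * sqrt M\<^sub>0 + K\<^sub>1 / sqrt (1 - (t k)\<^sup>2) + K\<^sub>2) * h + \<epsilon>" for k
  \<comment> \<open>The grid endpoints differ, so there is at least one step, and it fixes the sign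
    of \<open>h\<close>.\<close>
  have "N \<noteq> 0"
    using grid by (metis zero_neq_one)
  then have "0 \<le> h"
    using grid(3) by force
  \<comment> \<open>Integrability identifies the Bochner integral with the nonnegative one, and
    \<open>0 \<le> h\<close> lets \<open>ennreal\<close> split the product
    \<open>h * c j\<close>.\<close>
  have err: "ennsqrt (\<integral>\<^sup>+ x. ennreal ((norm (T' j x - T j x))\<^sup>2) \<partial>marginal T P\<^sub>0 j)
      \<le> ennreal h * ennreal (c j)" if "j < N" for j
    using step_error that \<open>0 \<le> h\<close>
    by (simp add: nn_integral_eq_integral ennsqrt_ennreal c_def ennreal_leI flip: ennreal_mult')
  have sum_eq: "(\<Sum>k<N. (\<Prod>j\<in>{k<..<N}. Lip (T' j)) * (ennreal h * ennreal (c k)))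
      = ennreal h * (\<Sum>k<N. (\<Prod>j\<in>{k<..<N}. Lip (T' j)) * ennreal (c k))"
    by (simp add: sum_distrib_left mult.left_commute)
  show ?thesis
    unfolding c_def[symmetric]
  proof (rule le_mult_W2_plusI)
    show "couplings P\<^sub>0 Q\<^sub>0 \<noteq> {}"
      using couplings_nonempty[OF init] by blast
    show "(\<Prod>j<N. Lip (T' j)) < \<infinity>"
      \<comment> \<open>The product over \<open>j < N\<close> is the assumed finite product at
        \<open>n = N - 1\<close>.\<close>
      using Lip_T' \<open>N \<noteq> 0\<close> by (cases N) (auto simp: lessThan_Suc_atMost)
  next
    fix \<gamma> assume \<gamma>: "\<gamma> \<in> couplings P\<^sub>0 Q\<^sub>0"
    have "\<exists>\<gamma>'\<in>couplings (marginal T P\<^sub>0 N) (marginal T' Q\<^sub>0 N).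
      coupling_cost \<gamma>' \<le> (\<Prod>j<N. Lip (T' j)) * coupling_cost \<gamma>
        + (\<Sum>k<N. (\<Prod>j\<in>{k<..<N}. Lip (T' j)) * (ennreal h * ennreal (c k)))"
      using Lip_T Lip_T' by (intro marginal_coupling \<gamma> err borel_measurable_Lip) auto
    then show "W2 (marginal T P\<^sub>0 N) (marginal T' Q\<^sub>0 N)
      \<le> (\<Prod>j<N. Lip (T' j)) * coupling_cost \<gamma>
        + ennreal h * (\<Sum>k<N. (\<Prod>j\<in>{k<..<N}. Lip (T' j)) * ennreal (c k))"
      \<comment> \<open>The transported coupling need not be optimal; its cost is one of those over
        which the infimum is taken.\<close>
      unfolding sum_eq W2_eq_INF_coupling_cost by (meson INF_lower2)
  qed
qed

end
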